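(* For every class $\mathcal F$ of (finite) graphs and every nonnegative integer $n$, the asymptotic dimension of $\mathcal F^{+n}$ equals the asymptotic dimension of $\mathcal F$.
   Context: All graphs are finite and simple. For a class $\mathcal F$ of graphs and integer $n\ge 0$, $\mathcal F^{+n}$ is the class of graphs $G$ for which there exists $Z\subseteq V(G)$ with $|Z|\le n$ and $G-Z\in\mathcal F$. A graph $G$ is regarded as the metric space $(V(G),d_G)$ with $d_G$ the shortest-path distance ($\infty$ between different components). For a (pseudo)metric space $(X,d)$, a family $\mathcal U$ of subsets of $X$ is $D$-bounded if each member has diameter at most $D$, and $r$-disjoint if $d(a,b)>r$ whenever $a,b$ lie in different members. A function $D_X:\mathbb{R}^+\to\mathbb{R}^+$ is an $n$-dimensional control function for $(X,d)$ if for every $r>0$ there is a cover $\mathcal U=\bigcup_{i=1}^{n+1}\mathcal U_i$ of $X$ with each $\mathcal U_i$ $r$-disjoint and each member of $\mathcal U$ $D_X(r)$-bounded. The asymptotic dimension of a family of spaces is the least $n$ for which a single function is an $n$-dimensional control function for every member ($\infty$ if none exists). *)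

theory Defs
  imports "Graph_Theory.Graph_Theory" "HOL-Library.Extended_Nat"
begin

text \<open>
  A space is a carrier set together with an extended distance function on it.  All quantifiers
  over points range over the carrier, so values of the distance outside it are irrelevant.
\<close>

type_synonym 'a space = "'a set \<times> ('a \<Rightarrow> 'a \<Rightarrow> ereal)"

definition bounded_family :: "('a \<Rightarrow> 'a \<Rightarrow> ereal) \<Rightarrow> real \<Rightarrow> 'a set set \<Rightarrow> bool" where
  "bounded_family d D \<U> \<longleftrightarrow> (\<forall>U\<in>\<U>. \<forall>a\<in>U. \<forall>b\<in>U. d a b \<le> ereal D)"

definition disjoint_family_dist :: "('a \<Rightarrow> 'a \<Rightarrow> ereal) \<Rightarrow> real \<Rightarrow> 'a set set \<Rightarrow> bool" where
  "disjoint_family_dist d r \<U> \<longleftrightarrow>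
     (\<forall>U\<in>\<U>. \<forall>V\<in>\<U>. U \<noteq> V \<longrightarrow> (\<forall>a\<in>U. \<forall>b\<in>V. d a b > ereal r))"

text \<open>
  Control functions map positive reals to positive reals; their values at nonpositive
  arguments are unconstrained.
\<close>

definition control_function :: "nat \<Rightarrow> 'a space \<Rightarrow> (real \<Rightarrow> real) \<Rightarrow> bool" where
  "control_function n S D \<longleftrightarrow>
     (\<forall>r>0. D r > 0) \<and>
     (\<forall>r>0. \<exists>\<U> :: nat \<Rightarrow> 'a set set.
        (\<Union>i\<in>{1..n+1}. \<Union>(\<U> i)) = fst S \<and>
        (\<forall>i\<in>{1..n+1}. disjoint_family_dist (snd S) r (\<U> i) \<and> bounded_family (snd S) (D r) (\<U> i)))"

text \<open>The infimum of the empty set in \<^typ>\<open>enat\<close> is \<open>\<infinity>\<close>.\<close>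

definition asdim :: "'a space set \<Rightarrow> enat" where
  "asdim \<S> = Inf {enat n | n. \<exists>D. \<forall>S\<in>\<S>. control_function n S D}"

text \<open>
  A finite simple graph is a \<^const>\<open>pair_graph\<close>: finite vertex set, and each edge
  represented by its two opposite arcs.  The distance is the infimum of the lengths of walks,
  which is \<open>\<infinity>\<close> if there are none.
\<close>

definition graph_dist :: "'a pair_pre_digraph \<Rightarrow> 'a \<Rightarrow> 'a \<Rightarrow> ereal" where
  "graph_dist G = wf_digraph.\<mu> (with_proj G) (\<lambda>_. 1)"

lemma (in pair_wf_digraph) graph_dist_conv_length:
  "graph_dist G u v = (INF p\<in>{p. awalk u p v}. ereal (length p))"
proof -
  have "awalk_cost (\<lambda>_. 1) p = length p" for p :: "('a \<times> 'a) awalk"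
    by (induct p) auto
  then show ?thesis
    by (simp add: graph_dist_def \<mu>_def)
qed

definition graph_space :: "'a pair_pre_digraph \<Rightarrow> 'a space" where
  "graph_space G = (pverts G, graph_dist G)"

definition graph_class_asdim :: "'a pair_pre_digraph set \<Rightarrow> enat" where
  "graph_class_asdim \<F> = asdim (graph_space ` \<F>)"

definition del_verts :: "'a pair_pre_digraph \<Rightarrow> 'a set \<Rightarrow> 'a pair_pre_digraph" where
  "del_verts G Z = \<lparr> pverts = pverts G - Z, parcs = {e \<in> parcs G. fst e \<notin> Z \<and> snd e \<notin> Z} \<rparr>"

lemma (in pair_wf_digraph) with_proj_del_verts:
  "with_proj (del_verts G Z) = with_proj G \<restriction> (pverts G - Z)"
  by (auto simp: with_proj_def del_verts_def induce_subgraph_def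
      dest: arc_fst_in_verts arc_snd_in_verts)

definition apex_class :: "'a pair_pre_digraph set \<Rightarrow> nat \<Rightarrow> 'a pair_pre_digraph set" where
  "apex_class \<F> n =
     {G. pair_graph G \<and> (\<exists>Z. Z \<subseteq> pverts G \<and> card Z \<le> n \<and> del_verts G Z \<in> \<F>)}"

end

theory Submission
  imports Defs
begin

text \<open>
  Deleting vertices cannot decrease distances, and a walk of length at most \<open>r\<close> that
  passes through a vertex \<open>z\<close> has both its ends in the ball of radius \<open>r\<close> around \<open>z\<close>.
  So, given a cover of \<open>G - z\<close> into \<open>r\<close>-disjoint \<open>D\<close>-bounded families, merge in each family all
  members that meet this ball into one set, and add \<open>z\<close> to it.  The families stay \<open>r\<close>-disjoint in
  \<open>G\<close>, and the merged set has diameter at most \<open>2 (r + D)\<close>.  Iterating bounds the control function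
  of \<open>G\<close> in terms of that of \<open>G - Z\<close> and \<open>|Z|\<close>; the converse inequality is the case
  \<open>Z = {}\<close>.
\<close>

section \<open>Adding one point to a space with a controlled cover\<close>

lemma bounded_family_mono:
  "bounded_family d D \<U> \<Longrightarrow> D \<le> D' \<Longrightarrow> bounded_family d D' \<U>"
  unfolding bounded_family_def by (meson ereal_less_eq(3) order_trans)

lemma control_function_mono:
  assumes "control_function k S D" and "\<And>r. r > 0 \<Longrightarrow> D r \<le> D' r"
  shows "control_function k S D'"
  using assms bounded_family_mono[of "snd S" "D r" _ "D' r" for r]
  unfolding control_function_def by (meson less_le_trans)

text \<open>The graph case abstracted to two distances: \<open>detour\<close> says that a pair close
  in \<open>d\<close> but not in \<open>d'\<close> owes this to \<open>z\<close>. Stating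
  \<open>triangle\<close> with real bounds avoids sums of infinite distances.\<close>

lemma control_function_add_point:
  fixes X :: "'a set" and d d' :: "'a \<Rightarrow> 'a \<Rightarrow> ereal"
  assumes cf: "control_function k (X - {z}, d') D"
    and z: "z \<in> X"
    and le: "\<And>a b. a \<in> X - {z} \<Longrightarrow> b \<in> X - {z} \<Longrightarrow> d a b \<le> d' a b"
    and detour: "\<And>a b r. a \<in> X - {z} \<Longrightarrow> b \<in> X - {z} \<Longrightarrow> d a b \<le> ereal r \<Longrightarrow>
      d' a b \<le> ereal r \<or> d a z \<le> ereal r \<and> d b z \<le> ereal r"
    and triangle: "\<And>a b c s t. d a b \<le> ereal s \<Longrightarrow> d b c \<le> ereal t \<Longrightarrow> d a c \<le> ereal (s + t)"
    and sym: "\<And>a b. d a b = d b a"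
    and refl: "d z z \<le> 0"
  shows "control_function k (X, d) (\<lambda>r. 2 * (r + D r))"
  unfolding control_function_def
proof (intro conjI allI impI)
  fix r :: real assume r: "r > 0"
  have Dpos: "D r > 0" using cf r unfolding control_function_def by blast
  then show "2 * (r + D r) > 0" using r by simp
  obtain \<U> :: "nat \<Rightarrow> 'a set set" where cover: "(\<Union>i\<in>{1..k+1}. \<Union>(\<U> i)) = X - {z}"
    and disj: "\<And>i. i \<in> {1..k+1} \<Longrightarrow> disjoint_family_dist d' r (\<U> i)"
    and bdd: "\<And>i. i \<in> {1..k+1} \<Longrightarrow> bounded_family d' (D r) (\<U> i)"
    using cf r unfolding control_function_def fst_conv snd_conv by meson
  define near where "near U \<longleftrightarrow> (\<exists>u\<in>U. d u z \<le> ereal r)" for U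
  \<comment> \<open>\<open>z\<close> joins the merged set of every family, even if no member is near
    it; a cover may overlap across families.\<close>
  define M where "M i = insert z (\<Union>{U \<in> \<U> i. near U})" for i
  define \<V> where "\<V> i = insert (M i) {U \<in> \<U> i. \<not> near U}" for i
  have sub: "U \<subseteq> X - {z}" if "i \<in> {1..k+1}" "U \<in> \<U> i" for i U
    using cover that by blast
  have bdU: "d a b \<le> ereal (D r)" if "i \<in> {1..k+1}" "U \<in> \<U> i" "a \<in> U" "b \<in> U" for i U a b
  proof -
    have "d a b \<le> d' a b" using sub[OF that(1,2)] that(3,4) le by blast
    also have "\<dots> \<le> ereal (D r)" using bdd[OF that(1)] that unfolding bounded_family_def by blast
    finally show ?thesis .
  qed
  \<comment> \<open>Only one of the two sets has to be unmerged: two distinct members of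
    \<open>\<V> i\<close> cannot both be \<open>M i\<close>, and \<open>sym\<close> handles the
    order.\<close>
  have far: "d a b > ereal r"
    if i: "i \<in> {1..k+1}" and U: "U \<in> \<U> i" "\<not> near U" and V: "V \<in> \<V> i" "V \<noteq> U"
      and a: "a \<in> U" and b: "b \<in> V" for i U V a b
  proof (rule ccontr)
    assume "\<not> d a b > ereal r"
    then have ab: "d a b \<le> ereal r" by simp
    have az: "\<not> d a z \<le> ereal r" using U(2) a unfolding near_def by blast
    with ab have "b \<noteq> z" by blast
    \<comment> \<open>\<open>W\<close> is \<open>V\<close> itself if \<open>V\<close> is unmerged,
      and otherwise a member merged into \<open>M i\<close>, which differs from \<open>U\<close>
      because it is near.\<close>
    then obtain W where W: "W \<in> \<U> i" "W \<noteq> U" "b \<in> W"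
      using V b U(2) unfolding \<V>_def M_def by blast
    \<comment> \<open>The other alternative of \<open>detour\<close> would place \<open>a\<close>
      within \<open>r\<close> of \<open>z\<close>, against \<open>az\<close>.\<close>
    have "d' a b \<le> ereal r"
      using detour[OF _ _ ab] az sub[OF i U(1)] sub[OF i W(1)] a W(3) by blast
    moreover have "d' a b > ereal r"
      using disj[OF i] U(1) W a unfolding disjoint_family_dist_def by blast
    ultimately show False by simp
  qed
  \<comment> \<open>Moving inside the member of \<open>a\<close> to its point \<open>u\<close> near
    \<open>z\<close> costs \<open>D r\<close>, and going on to \<open>z\<close> costs
    \<open>r\<close>. Passing through \<open>z\<close> then gives the diameter bound for
    \<open>M i\<close>.\<close>
  have centre: "d a z \<le> ereal (D r + r)" if i: "i \<in> {1..k+1}" and a: "a \<in> M i" for i a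
  proof (cases "a = z")
    case True
    have "d z z \<le> ereal (D r + r)"
      by (rule order_trans[OF refl]) (use r Dpos in simp)
    then show ?thesis using True by simp
  next
    case False
    then obtain U u where "U \<in> \<U> i" "a \<in> U" "u \<in> U" "d u z \<le> ereal r"
      using a unfolding M_def near_def by blast
    then show ?thesis using triangle bdU[OF i] by blast
  qed
  have "disjoint_family_dist d r (\<V> i)" if i: "i \<in> {1..k+1}" for i
    unfolding disjoint_family_dist_def
  proof (intro ballI impI)
    fix U V a b assume *: "U \<in> \<V> i" "V \<in> \<V> i" "U \<noteq> V" "a \<in> U" "b \<in> V"
    show "d a b > ereal r"
    proof (cases "U = M i")
      case True
      then have "V \<in> \<U> i" "\<not> near V" using * unfolding \<V>_def by auto
      then show ?thesis using far[OF i _ _ *(1,3,5,4)] sym[of a b] by simp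
    next
      case False
      then have "U \<in> \<U> i" "\<not> near U" using * unfolding \<V>_def by auto
      then show ?thesis using far[OF i _ _ *(2) *(3)[symmetric] *(4,5)] by simp
    qed
  qed
  moreover have "bounded_family d (2 * (r + D r)) (\<V> i)" if i: "i \<in> {1..k+1}" for i
    unfolding bounded_family_def
  proof (intro ballI)
    fix U a b assume *: "U \<in> \<V> i" "a \<in> U" "b \<in> U"
    show "d a b \<le> ereal (2 * (r + D r))"
    proof (cases "U = M i")
      case True
      then have "d a z \<le> ereal (D r + r)" "d z b \<le> ereal (D r + r)"
        using centre[OF i] * sym by auto
      from triangle[OF this] show ?thesis by (simp add: algebra_simps)
    next
      case False
      then have "d a b \<le> ereal (D r)" using bdU[OF i] * unfolding \<V>_def by blast
      also have "\<dots> \<le> ereal (2 * (r + D r))" using r Dpos by simp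
      finally show ?thesis .
    qed
  qed
  moreover have "\<Union>(\<V> i) = insert z (\<Union>(\<U> i))" for i
    unfolding \<V>_def M_def by blast
  then have "(\<Union>i\<in>{1..k+1}. \<Union>(\<V> i)) = insert z (\<Union>i\<in>{1..k+1}. \<Union>(\<U> i))"
    by auto
  with cover z have "(\<Union>i\<in>{1..k+1}. \<Union>(\<V> i)) = X" by auto
  ultimately show "\<exists>\<V>. (\<Union>i\<in>{1..k+1}. \<Union>(\<V> i)) = fst (X, d) \<and>
      (\<forall>i\<in>{1..k+1}. disjoint_family_dist (snd (X, d)) r (\<V> i) \<and>
        bounded_family (snd (X, d)) (2 * (r + D r)) (\<V> i))"
    unfolding fst_conv snd_conv by blast
qed

section \<open>Graph distance in terms of walks\<close>

lemma (in pair_wf_digraph) graph_dist_le_iff: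
  "graph_dist G u v \<le> ereal r \<longleftrightarrow> (\<exists>p. awalk u p v \<and> real (length p) \<le> r)"
proof
  assume "graph_dist G u v \<le> ereal r"
  \<comment> \<open>Strict inequality yields an actual walk below the bound; walk lengths are
    integers, so being less than \<open>\<lfloor>r\<rfloor> + 1\<close> already means being at most
    \<open>r\<close>.\<close>
  also have "ereal r < ereal (of_int (\<lfloor>r\<rfloor> + 1))"
    using floor_correct[of r] by simp
  finally obtain p where p: "awalk u p v" "ereal (length p) < ereal (of_int (\<lfloor>r\<rfloor> + 1))"
    unfolding graph_dist_conv_length INF_less_iff by blast
  then have "real_of_int (int (length p)) < of_int (\<lfloor>r\<rfloor> + 1)" by simp
  then have "int (length p) \<le> \<lfloor>r\<rfloor>" unfolding of_int_less_iff by simp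
  then have "real (length p) \<le> r" by (simp add: le_floor_iff)
  with p(1) show "\<exists>p. awalk u p v \<and> real (length p) \<le> r" by blast
next
  assume "\<exists>p. awalk u p v \<and> real (length p) \<le> r"
  then show "graph_dist G u v \<le> ereal r"
    unfolding graph_dist_conv_length by (auto intro: INF_lower2)
qed

lemma (in pair_wf_digraph) graph_dist_triangle:
  assumes "graph_dist G u v \<le> ereal s" "graph_dist G v w \<le> ereal t"
  shows "graph_dist G u w \<le> ereal (s + t)"
proof -
  obtain p q where "awalk u p v" "real (length p) \<le> s" "awalk v q w" "real (length q) \<le> t"
    using assms unfolding graph_dist_le_iff by blast
  then have "awalk u (p @ q) w" "real (length (p @ q)) \<le> s + t"
    by (auto intro: awalk_appendI)
  then show ?thesis unfolding graph_dist_le_iff by blast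
qed

lemma length_rev_path: "length (rev_path p) = length p"
  by (induct p) auto

text \<open>Reversing a walk keeps its length, which gives one inequality for all pairs and hence
  both.\<close>

lemma (in pair_sym_digraph) graph_dist_sym: "graph_dist G u v = graph_dist G v u"
proof -
  have "graph_dist G u v \<le> graph_dist G v u" for u v
    unfolding graph_dist_conv_length
  proof (rule INF_greatest)
    fix p assume "p \<in> {p. awalk v p u}"
    then have "rev_path p \<in> {p. awalk u p v}" by simp
    then show "(INF p\<in>{p. awalk u p v}. ereal (length p)) \<le> ereal (length p)"
      by (rule INF_lower2) (simp add: length_rev_path)
  qed
  then show ?thesis by (simp add: order_antisym)
qed

section \<open>Vertex deletion and its effect on distances\<close>

lemma pair_wf_digraph_del_verts:
  "pair_wf_digraph G \<Longrightarrow> pair_wf_digraph (del_verts G Z)"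
  unfolding pair_wf_digraph_def del_verts_def by auto

text \<open>\<open>apex_class\<close> demands \<open>pair_graph\<close> of its members, so this
  keeps intermediate graphs eligible when vertices are removed one at a time.\<close>

lemma pair_graph_del_verts:
  assumes "pair_graph G"
  shows "pair_graph (del_verts G Z)"
proof -
  interpret pair_graph G by fact
  interpret H: pair_wf_digraph "del_verts G Z"
    by (rule pair_wf_digraph_del_verts) unfold_locales
  show ?thesis
  proof unfold_locales
    show "finite (pverts (del_verts G Z))" "finite (parcs (del_verts G Z))"
      using pair_finite_verts pair_finite_arcs by (auto simp: del_verts_def)
    show "symmetric (with_proj (del_verts G Z))"
      using pair_sym_arcs unfolding symmetric_def
      by (auto simp: del_verts_def intro!: symI dest: symD)
  qed (use pair_no_loops in \<open>auto simp: del_verts_def\<close>)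
qed

text \<open>A walk is a list of arcs, so the same \<open>p\<close> can be read in both graphs. The
  start \<open>u\<close> is generalised in the induction because it moves to the next
  vertex.\<close>

lemma (in pair_wf_digraph) awalk_del_verts_iff:
  "pre_digraph.awalk (with_proj (del_verts G Z)) u p v \<longleftrightarrow>
    awalk u p v \<and> set (awalk_verts u p) \<inter> Z = {}"
proof -
  interpret H: pair_wf_digraph "del_verts G Z"
    by (rule pair_wf_digraph_del_verts) unfold_locales
  show ?thesis
    by (induct p arbitrary: u)
      (auto simp: awalk_Nil_iff awalk_Cons_iff H.awalk_Nil_iff H.awalk_Cons_iff,
       auto simp: del_verts_def dest: awalk_hd_in_verts hd_in_awalk_verts)
qed

lemma control_function_del_vertex:
  assumes "pair_graph G" and z: "z \<in> pverts G"
    and cf: "control_function k (graph_space (del_verts G {z})) D"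
  shows "control_function k (graph_space G) (\<lambda>r. 2 * (r + D r))"
proof -
  interpret pair_graph G by fact
  interpret H: pair_wf_digraph "del_verts G {z}"
    by (rule pair_wf_digraph_del_verts) unfold_locales
  let ?H = "del_verts G {z}"
  have H_space: "graph_space ?H = (pverts G - {z}, graph_dist ?H)"
    by (simp add: graph_space_def del_verts_def)
  show ?thesis
    unfolding graph_space_def[of G]
  proof (rule control_function_add_point[OF cf[unfolded H_space] z])
    show "graph_dist G a b \<le> graph_dist ?H a b" for a b
      unfolding graph_dist_conv_length H.graph_dist_conv_length
      by (rule INF_superset_mono) (auto simp: awalk_del_verts_iff)
    \<comment> \<open>A short walk either avoids \<open>z\<close> and survives the deletion, or
      splits at \<open>z\<close> into two pieces, neither longer than the whole.\<close>
    show "graph_dist ?H a b \<le> ereal r \<or> graph_dist G a z \<le> ereal r \<and> graph_dist G b z \<le> ereal r"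
      if ab: "graph_dist G a b \<le> ereal r" for a b r
    proof -
      obtain p where p: "awalk a p b" "real (length p) \<le> r"
        using ab unfolding graph_dist_le_iff by blast
      show ?thesis
      proof (cases "z \<in> set (awalk_verts a p)")
        case False
        then show ?thesis using p unfolding H.graph_dist_le_iff awalk_del_verts_iff by blast
      next
        case True
        then obtain q s where "p = q @ s" "awalk a q z" "awalk z s b"
          using awalk_decomp[OF p(1)] by blast
        moreover from this have "real (length q) \<le> r" "real (length s) \<le> r" using p(2) by auto
        ultimately have "graph_dist G a z \<le> ereal r" "graph_dist G z b \<le> ereal r"
          unfolding graph_dist_le_iff by blast+
        then show ?thesis using graph_dist_sym[of b z] by simp
      qed
    qed
    \<comment> \<open>The empty walk needs \<open>z\<close> to be a vertex; elsewhere the distance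
      is infinite.\<close>
    have "awalk z [] z" using z by (simp add: awalk_Nil_iff)
    then show "graph_dist G z z \<le> 0"
      unfolding zero_ereal_def graph_dist_le_iff by force
  qed (fact graph_dist_triangle graph_dist_sym)+
qed

section \<open>Induction on the number of deleted vertices\<close>

lemma del_verts_empty [simp]: "del_verts G {} = G"
  by (simp add: del_verts_def)

lemma del_verts_del_verts: "del_verts (del_verts G Y) Z = del_verts G (Y \<union> Z)"
  by (auto simp: del_verts_def)

lemma apex_class_Suc_cases:
  assumes "G \<in> apex_class \<F> (Suc n)"
  obtains "G \<in> apex_class \<F> n"
  | z where "z \<in> pverts G" "del_verts G {z} \<in> apex_class \<F> n"
proof -
  obtain Z where G: "pair_graph G" and Z: "Z \<subseteq> pverts G" "card Z \<le> Suc n" "del_verts G Z \<in> \<F>"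
    using assms unfolding apex_class_def by blast
  show ?thesis
  proof (cases "Z = {}")
    case True
    then show ?thesis using that(1) G Z unfolding apex_class_def by force
  next
    case False
    \<comment> \<open>Deleting one vertex of \<open>Z\<close> first leaves at most \<open>n\<close>
      to delete from the smaller graph.\<close>
    then obtain z where z: "z \<in> Z" by blast
    have "del_verts (del_verts G {z}) (Z - {z}) = del_verts G Z"
      using z by (simp add: del_verts_del_verts insert_absorb)
    moreover have "card (Z - {z}) \<le> n"
      using Z(2) z by (simp add: card_Diff_singleton)
    moreover have "Z - {z} \<subseteq> pverts (del_verts G {z})"
      using Z(1) by (auto simp: del_verts_def)
    ultimately have "del_verts G {z} \<in> apex_class \<F> n"
      using Z(3) pair_graph_del_verts[OF G] unfolding apex_class_def mem_Collect_eq by metis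
    then show ?thesis using that(2) z Z(1) by blast
  qed
qed

text \<open>Each induction step replaces \<open>D\<close> by \<open>2 * (r + D r)\<close>, a change
  that does not depend on \<open>G\<close>, so one function serves the whole class.\<close>

lemma apex_class_control_function:
  assumes D: "\<And>G. G \<in> \<F> \<Longrightarrow> control_function k (graph_space G) D"
  shows "\<exists>D'. \<forall>G\<in>apex_class \<F> n. control_function k (graph_space G) D'"
proof (induction n)
  case 0
  have "del_verts G Z = G" if "pair_graph G" "Z \<subseteq> pverts G" "card Z \<le> 0" for G and Z :: "'a set"
  proof -
    interpret pair_graph G by fact
    \<comment> \<open>Infinite sets also have \<open>card\<close> 0, so emptiness rests on the
      finiteness of the vertex set.\<close>
    have "Z = {}" using that finite_subset[OF _ pair_finite_verts] by auto
    then show ?thesis by simp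
  qed
  then have "apex_class \<F> 0 \<subseteq> \<F>" unfolding apex_class_def by force
  then show ?case using D by blast
next
  case (Suc n)
  then obtain D' where D': "\<And>G. G \<in> apex_class \<F> n \<Longrightarrow> control_function k (graph_space G) D'"
    by blast
  have "control_function k (graph_space G) (\<lambda>r. 2 * (r + D' r))"
    if "G \<in> apex_class \<F> (Suc n)" for G
    using that
  proof (cases rule: apex_class_Suc_cases)
    case 1
    show ?thesis
    proof (rule control_function_mono[OF D'[OF 1]])
      fix r :: real assume r: "r > 0"
      \<comment> \<open>Positivity of \<open>D'\<close> comes from a member of the class; over an
        empty class \<open>D'\<close> would be arbitrary.\<close>
      then have "D' r > 0" using D'[OF 1] unfolding control_function_def by blast
      with r show "D' r \<le> 2 * (r + D' r)" by simp
    qed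
  next
    case (2 z)
    have "pair_graph G" using that unfolding apex_class_def by blast
    then show ?thesis by (rule control_function_del_vertex[OF _ 2(1) D'[OF 2(2)]])
  qed
  then show ?case by blast
qed

theorem theorem1p8:
  fixes \<F> :: "'a pair_pre_digraph set" and n :: nat
  assumes "\<And>G. G \<in> \<F> \<Longrightarrow> pair_graph G"
  shows "graph_class_asdim (apex_class \<F> n) = graph_class_asdim \<F>"
proof -
  have "\<F> \<subseteq> apex_class \<F> n"
    using assms unfolding apex_class_def by (force intro: exI[of _ "{}"])
  \<comment> \<open>Both dimensions are infima over \<open>k\<close>, so it suffices that the same
    \<open>k\<close> are admissible: restriction to a subclass gives one direction, the induction
    the other.\<close>
  then have "(\<exists>D. \<forall>S\<in>graph_space ` apex_class \<F> n. control_function k S D) \<longleftrightarrow>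
      (\<exists>D. \<forall>S\<in>graph_space ` \<F>. control_function k S D)" for k
    using apex_class_control_function[where \<F> = \<F> and k = k and n = n]
    unfolding ball_simps by (meson subsetD)
  then show ?thesis unfolding graph_class_asdim_def asdim_def by simp
qed

end
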